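(* For any integer $n\ge 2$, $\dim(P_n\boxtimes P_n)=3$.
   Context: $P_n$ is the path of order $n$. A set $S\subseteq V(G)$ of a connected graph $G$ is a metric generator if for every two distinct vertices $x,y$ there is $s\in S$ with $d_G(s,x)\ne d_G(s,y)$ (shortest-path distance); $\dim(G)$ is the minimum cardinality of a metric generator. The strong product $G\boxtimes H$ has vertex set $V(G)\times V(H)$, with $(a,b)$ and $(c,d)$ adjacent iff ($a=c$ and $bd\in E(H)$) or ($b=d$ and $ac\in E(G)$) or ($ac\in E(G)$ and $bd\in E(H)$). *)

theory Defs
  imports "Graph_Theory.Graph_Theory"
begin

text \<open>
  A finite simple graph is a \<^locale>\<open>pair_graph\<close>: an undirected edge is represented by its two
  orientations.
\<close>

definition path_graph :: "nat \<Rightarrow> nat pair_pre_digraph" where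
  "path_graph n =
     \<lparr> pverts = {..<n},
       parcs = {(i, j). i < n \<and> j < n \<and> (j = Suc i \<or> i = Suc j)} \<rparr>"

definition strong_product ::
    "'a pair_pre_digraph \<Rightarrow> 'b pair_pre_digraph \<Rightarrow> ('a \<times> 'b) pair_pre_digraph"
    (infixr "\<boxtimes>" 75) where
  "G \<boxtimes> H =
     \<lparr> pverts = pverts G \<times> pverts H,
       parcs = {((a, b), (c, d)).
         a \<in> pverts G \<and> c \<in> pverts G \<and> b \<in> pverts H \<and> d \<in> pverts H \<and>
         ((a = c \<and> (b, d) \<in> parcs H) \<or>
          (b = d \<and> (a, c) \<in> parcs G) \<or>
          ((a, c) \<in> parcs G \<and> (b, d) \<in> parcs H))} \<rparr>"

text \<open>
  With unit weights, the infimum of walk costs is the shortest-path distance; it is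
  \<open>\<infinity>\<close> for vertices in different components.
\<close>

definition graph_dist :: "'a pair_pre_digraph \<Rightarrow> 'a \<Rightarrow> 'a \<Rightarrow> ereal" where
  "graph_dist G u v = wf_digraph.\<mu> (with_proj G) (\<lambda>_. 1) u v"

lemma graph_dist_eq_INF_length:
  assumes "pair_wf_digraph G"
  shows "graph_dist G u v =
    (INF p \<in> {p. pre_digraph.awalk (with_proj G) u p v}. ereal (real (length p)))"
proof -
  interpret pair_wf_digraph G by fact
  have "awalk_cost (\<lambda>_. 1) p = real (length p)" for p
    by (induction p) auto
  then show ?thesis by (simp add: graph_dist_def \<mu>_def)
qed

definition metric_generator :: "'a pair_pre_digraph \<Rightarrow> 'a set \<Rightarrow> bool" where
  "metric_generator G S \<longleftrightarrow> S \<subseteq> pverts G \<and>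
     (\<forall>x \<in> pverts G. \<forall>y \<in> pverts G. x \<noteq> y \<longrightarrow>
        (\<exists>s \<in> S. graph_dist G s x \<noteq> graph_dist G s y))"

text \<open>Finiteness is required because \<^const>\<open>card\<close> is 0 on infinite sets.\<close>

definition metric_dim :: "'a pair_pre_digraph \<Rightarrow> nat" where
  "metric_dim G = (LEAST k. \<exists>S. metric_generator G S \<and> finite S \<and> card S = k)"

lemma pair_graph_path_graph: "pair_graph (path_graph n)"
proof -
  have "finite {(i, j). i < n \<and> j < n \<and> (j = Suc i \<or> i = Suc j)}"
    by (rule finite_subset[of _ "{..<n} \<times> {..<n}"]) auto
  then show ?thesis
    by unfold_locales (auto simp: path_graph_def symmetric_def intro!: symI)
qed

lemma pair_graph_strong_product:
  assumes "pair_graph G" "pair_graph H"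
  shows "pair_graph (G \<boxtimes> H)"
proof -
  interpret G: pair_graph G by fact
  interpret H: pair_graph H by fact
  have fin: "finite (parcs (G \<boxtimes> H))"
    by (rule finite_subset[of _ "(pverts G \<times> pverts H) \<times> (pverts G \<times> pverts H)"])
      (auto simp: strong_product_def)
  have G: "(b, a) \<in> parcs G" if "(a, b) \<in> parcs G" for a b
    using that G.pair_sym_arcs by (auto simp: symmetric_def dest: symD)
  have H: "(b, a) \<in> parcs H" if "(a, b) \<in> parcs H" for a b
    using that H.pair_sym_arcs by (auto simp: symmetric_def dest: symD)
  show ?thesis
    using fin
    by unfold_locales
      (auto simp: strong_product_def symmetric_def dest: G H G.pair_no_loops H.pair_no_loops
        intro!: symI)
qed

text \<open>For symmetric digraphs, strong connectedness is connectedness.\<close>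

lemma connected_path_graph:
  assumes "n \<ge> 1"
  shows "strongly_connected (with_proj (path_graph n))"
proof -
  interpret pair_graph "path_graph n" by (rule pair_graph_path_graph)
  have from0: "0 \<rightarrow>\<^sup>*\<^bsub>with_proj (path_graph n)\<^esub> i" if "i < n" for i
    using that
  proof (induction i)
    case 0
    then show ?case by (intro reachable_refl) (auto simp: path_graph_def)
  next
    case (Suc i)
    then have "i \<rightarrow>\<^bsub>with_proj (path_graph n)\<^esub> Suc i"
      by (auto simp: path_graph_def)
    with Suc show ?case by (auto intro: reachable_adj_trans)
  qed
  have "i \<rightarrow>\<^sup>*\<^bsub>with_proj (path_graph n)\<^esub> j" if "i < n" "j < n" for i j
    using from0[OF that(1)] from0[OF that(2)] symmetric_reachable[OF sym_arcs]
    by (blast intro: reachable_trans)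
  with assms show ?thesis
    by (auto simp: strongly_connected_def path_graph_def lessThan_empty_iff)
qed

lemma connected_strong_product:
  assumes "pair_graph G" "pair_graph H"
    and G: "strongly_connected (with_proj G)" and H: "strongly_connected (with_proj H)"
  shows "strongly_connected (with_proj (G \<boxtimes> H))"
proof -
  interpret G: pair_graph G by fact
  interpret H: pair_graph H by fact
  interpret P: pair_graph "G \<boxtimes> H" by (rule pair_graph_strong_product) fact+
  have 1: "(a, b) \<rightarrow>\<^sup>*\<^bsub>with_proj (G \<boxtimes> H)\<^esub> (c, b)"
    if "a \<rightarrow>\<^sup>*\<^bsub>with_proj G\<^esub> c" "b \<in> pverts H" for a b c
    using that
  proof (induction rule: G.reachable_induct)
    case base
    then show ?case by (intro P.reachable_refl) (auto simp: strong_product_def)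
  next
    case (step x y)
    have "(x, b) \<rightarrow>\<^bsub>with_proj (G \<boxtimes> H)\<^esub> (y, b)"
      using step by (auto simp: strong_product_def dest: G.in_arcsD1 G.in_arcsD2)
    with step show ?case by (auto intro: P.reachable_adj_trans)
  qed
  have 2: "(a, b) \<rightarrow>\<^sup>*\<^bsub>with_proj (G \<boxtimes> H)\<^esub> (a, d)"
    if "b \<rightarrow>\<^sup>*\<^bsub>with_proj H\<^esub> d" "a \<in> pverts G" for a b d
    using that
  proof (induction rule: H.reachable_induct)
    case base
    then show ?case by (intro P.reachable_refl) (auto simp: strong_product_def)
  next
    case (step x y)
    have "(a, x) \<rightarrow>\<^bsub>with_proj (G \<boxtimes> H)\<^esub> (a, y)"
      using step by (auto simp: strong_product_def dest: H.in_arcsD1 H.in_arcsD2)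
    with step show ?case by (auto intro: P.reachable_adj_trans)
  qed
  have "p \<rightarrow>\<^sup>*\<^bsub>with_proj (G \<boxtimes> H)\<^esub> q"
    if "p \<in> pverts (G \<boxtimes> H)" "q \<in> pverts (G \<boxtimes> H)" for p q
  proof -
    obtain a b c d where [simp]: "p = (a, b)" "q = (c, d)" by (cases p, cases q)
    have *: "a \<in> pverts G" "b \<in> pverts H" "c \<in> pverts G" "d \<in> pverts H"
      using that by (auto simp: strong_product_def)
    have "(a, b) \<rightarrow>\<^sup>*\<^bsub>with_proj (G \<boxtimes> H)\<^esub> (c, b)"
      using * G by (intro 1) (auto simp: strongly_connected_def)
    moreover have "(c, b) \<rightarrow>\<^sup>*\<^bsub>with_proj (G \<boxtimes> H)\<^esub> (c, d)"
      using * H by (intro 2) (auto simp: strongly_connected_def)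
    ultimately show ?thesis by (auto intro: P.reachable_trans)
  qed
  moreover have "pverts (G \<boxtimes> H) \<noteq> {}"
    using G H by (auto simp: strongly_connected_def strong_product_def)
  ultimately show ?thesis
    by (auto simp: strongly_connected_def)
qed

end

theory Submission
  imports Defs
begin

text \<open>
  Distance in \<open>P\<^sub>n \<boxtimes> P\<^sub>n\<close> is the Chebyshev distance of the coordinates, so three corners of the
  grid resolve all vertices by a case distinction on the sides of the two diagonals. Two vertices
  \<open>s, t\<close> never suffice: the pairs of distances to \<open>s\<close> and \<open>t\<close> have entries below \<open>n\<close>, and
  the first entry is \<open>0\<close> only at \<open>s\<close>, so there are at most \<open>1 + (n - 1) n < n\<^sup>2\<close> of them.
\<close>

lemma graph_dist_eqI:
  assumes "pair_wf_digraph G"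
    and "pre_digraph.awalk (with_proj G) u p v" "length p = k"
    and "\<And>q. pre_digraph.awalk (with_proj G) u q v \<Longrightarrow> k \<le> length q"
  shows "graph_dist G u v = ereal (real k)"
  unfolding graph_dist_eq_INF_length[OF assms(1)]
  using assms(2-4) by (intro INF_eqI) auto

text \<open>One of the two truncated differences is zero, so their sum is the absolute difference.\<close>

definition chebyshev_dist :: "nat \<times> nat \<Rightarrow> nat \<times> nat \<Rightarrow> nat" where
  "chebyshev_dist u v =
     max ((fst u - fst v) + (fst v - fst u)) ((snd u - snd v) + (snd v - snd u))"

lemma pverts_grid: "pverts (path_graph n \<boxtimes> path_graph n) = {..<n} \<times> {..<n}"
  by (simp add: strong_product_def path_graph_def)

text \<open>A strong product arc moves each coordinate by at most one and at least one of them by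
  exactly one. Walks can thus be measured by \<open>chebyshev_dist\<close> alone.\<close>

lemma parcs_grid:
  "(u, v) \<in> parcs (path_graph n \<boxtimes> path_graph n) \<longleftrightarrow>
     u \<in> {..<n} \<times> {..<n} \<and> v \<in> {..<n} \<times> {..<n} \<and> chebyshev_dist u v = 1"
  by (cases u; cases v)
    (auto simp: strong_product_def path_graph_def chebyshev_dist_def max_def split: if_splits)

lemma chebyshev_dist_triangle:
  "chebyshev_dist u w \<le> chebyshev_dist u v + chebyshev_dist v w"
proof -
  have *: "(a - c) + (c - a) \<le> ((a - b) + (b - a)) + ((b - c) + (c - b))" for a b c :: nat
    by linarith
  show ?thesis
    unfolding chebyshev_dist_def
    by (intro max.boundedI order_trans[OF *[of _ _ "fst v"]] order_trans[OF *[of _ _ "snd v"]]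
        add_mono max.cobounded1 max.cobounded2)
qed

lemma chebyshev_dist_eq_0_iff: "chebyshev_dist u v = 0 \<longleftrightarrow> u = v"
  by (auto simp: chebyshev_dist_def prod_eq_iff)

lemma chebyshev_dist_less:
  "u \<in> {..<n} \<times> {..<n} \<Longrightarrow> v \<in> {..<n} \<times> {..<n} \<Longrightarrow> chebyshev_dist u v < n"
  by (auto simp: chebyshev_dist_def)

text \<open>Like a chess king, \<open>w\<close> moves both coordinates of \<open>u\<close> one unit
  toward \<open>v\<close>, so the larger difference falls by one.\<close>

lemma chebyshev_step:
  assumes "u \<in> {..<n} \<times> {..<n}" "v \<in> {..<n} \<times> {..<n}" "chebyshev_dist u v = Suc k"
  obtains w where "w \<in> {..<n} \<times> {..<n}" "chebyshev_dist u w = 1" "chebyshev_dist w v = k"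
proof
  define step :: "nat \<Rightarrow> nat \<Rightarrow> nat" where
    "step a b = (if a < b then a + 1 else if b < a then a - 1 else a)" for a b
  let ?w = "(step (fst u) (fst v), step (snd u) (snd v))"
  show "?w \<in> {..<n} \<times> {..<n}"
    using assms(1,2) by (auto simp: step_def)
  define d :: "nat \<Rightarrow> nat \<Rightarrow> nat" where "d a b = (a - b) + (b - a)" for a b
  \<comment> \<open>A coordinate that already agrees stays put; truncated subtraction covers this
    case, as \<open>0 - 1 = 0\<close>.\<close>
  have d_step: "d a (step a b) = min 1 (d a b)" "d (step a b) b = d a b - 1" for a b
    by (auto simp: d_def step_def)
  have cheb: "chebyshev_dist x y = max (d (fst x) (fst y)) (d (snd x) (snd y))" for x y
    by (simp add: chebyshev_dist_def d_def)
  show "chebyshev_dist u ?w = 1" "chebyshev_dist ?w v = k"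
    using assms(3) unfolding cheb fst_conv snd_conv d_step by linarith+
qed

lemma pair_graph_grid: "pair_graph (path_graph n \<boxtimes> path_graph n)"
  by (intro pair_graph_strong_product pair_graph_path_graph)

text \<open>Iterating \<open>chebyshev_step\<close> gives a walk of the required length. No walk is
  shorter, since by the triangle inequality each arc reduces the distance to \<open>v\<close> by at
  most one.\<close>

lemma graph_dist_grid:
  assumes "u \<in> {..<n} \<times> {..<n}" "v \<in> {..<n} \<times> {..<n}"
  shows "graph_dist (path_graph n \<boxtimes> path_graph n) u v = ereal (real (chebyshev_dist u v))"
proof -
  let ?G = "path_graph n \<boxtimes> path_graph n"
  interpret pair_graph ?G by (rule pair_graph_grid)
  have "\<exists>p. awalk u p v \<and> length p = k" if "chebyshev_dist u v = k" for k
    using that assms(1)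
  proof (induction k arbitrary: u)
    case 0
    then show ?case
      using assms(2) by (intro exI[of _ "[]"])
        (auto simp: chebyshev_dist_eq_0_iff awalk_Nil_iff pverts_grid)
  next
    case (Suc k)
    from chebyshev_step[OF Suc.prems(2) assms(2) Suc.prems(1)] obtain w
      where w: "w \<in> {..<n} \<times> {..<n}" "chebyshev_dist u w = 1" "chebyshev_dist w v = k" .
    from Suc.IH[OF w(3) w(1)] obtain p where "awalk w p v" "length p = k" by blast
    with w Suc.prems(2) show ?case
      by (intro exI[of _ "(u, w) # p"]) (simp add: awalk_Cons_iff parcs_grid)
  qed
  then obtain p where p: "awalk u p v" "length p = chebyshev_dist u v" by blast
  have "chebyshev_dist u v \<le> length q" if "awalk u q v" for u q
    using that
  proof (induction q arbitrary: u)
    case Nil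
    then show ?case by (simp add: awalk_Nil_iff chebyshev_dist_eq_0_iff)
  next
    case (Cons e q)
    then have "e \<in> parcs ?G" "fst e = u" and q: "awalk (snd e) q v"
      by (auto simp: awalk_Cons_iff)
    then have "chebyshev_dist u (snd e) = 1"
      by (metis parcs_grid prod.collapse)
    with chebyshev_dist_triangle[of u v "snd e"] Cons.IH[OF q] show ?case by simp
  qed
  then show ?thesis
    using graph_dist_eqI[OF pair_wf_digraph_axioms p] by blast
qed

lemma metric_generator_grid_iff:
  "metric_generator (path_graph n \<boxtimes> path_graph n) S \<longleftrightarrow>
     S \<subseteq> {..<n} \<times> {..<n} \<and>
     (\<forall>x \<in> {..<n} \<times> {..<n}. \<forall>y \<in> {..<n} \<times> {..<n}. x \<noteq> y \<longrightarrow>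
        (\<exists>s \<in> S. chebyshev_dist s x \<noteq> chebyshev_dist s y))"
proof (cases "S \<subseteq> {..<n} \<times> {..<n}")
  case True
  then have "graph_dist (path_graph n \<boxtimes> path_graph n) s x = ereal (real (chebyshev_dist s x))"
    if "s \<in> S" "x \<in> {..<n} \<times> {..<n}" for s x
    using that by (intro graph_dist_grid) auto
  then show ?thesis
    using True unfolding metric_generator_def pverts_grid by (simp cong: bex_cong)
qed (simp add: metric_generator_def pverts_grid)

text \<open>The distances B to \<open>(0, m)\<close> and C to \<open>(m, 0)\<close> leave two
  candidates: (B, C) if \<open>x + y \<ge> m\<close>, and (m - C, m - B) if
  \<open>x + y \<le> m\<close>. These are mirror images in the line \<open>x + y = m\<close>, and
  the distance to the origin separates them unless they coincide.\<close>

lemma three_corners_resolve: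
  assumes "x \<le> m" "y \<le> m" "x' \<le> m" "y' \<le> m"
    and "chebyshev_dist (0, 0) (x, y) = chebyshev_dist (0, 0) (x', y')"
    and "chebyshev_dist (0, m) (x, y) = chebyshev_dist (0, m) (x', y')"
    and "chebyshev_dist (m, 0) (x, y) = chebyshev_dist (m, 0) (x', y')"
  shows "x = x' \<and> y = y'"
proof -
  \<comment> \<open>Naming the complements removes truncated subtraction, leaving linear equations
    with \<open>max\<close>.\<close>
  obtain p q p' q' where m: "m = y + p" "m = x + q" "m = y' + p'" "m = x' + q'"
    using assms(1-4) by (metis le_iff_add)
  then have "m - y = p" "m - x = q" "m - y' = p'" "m - x' = q'"
    by simp_all
  with assms have "max x y = max x' y'" "max x p = max x' p'" "max q y = max q' y'"
    by (simp_all add: chebyshev_dist_def)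
  with m show ?thesis by linarith
qed

lemma three_corners_generate:
  assumes "n \<ge> 2"
  shows "metric_generator (path_graph n \<boxtimes> path_graph n) {(0, 0), (0, n - 1), (n - 1, 0)}"
proof -
  have "x = y"
    if "x \<in> {..<n} \<times> {..<n}" "y \<in> {..<n} \<times> {..<n}"
      and "\<forall>s \<in> {(0, 0), (0, n - 1), (n - 1, 0)}. chebyshev_dist s x = chebyshev_dist s y"
    for x y
    using that three_corners_resolve[of "fst x" "n - 1" "snd x" "fst y" "snd y"]
    by (force simp: prod_eq_iff)
  with assms show ?thesis unfolding metric_generator_grid_iff by auto
qed

lemma two_vertices_not_resolving:
  assumes "n \<ge> 2" "s \<in> {..<n} \<times> {..<n}" "t \<in> {..<n} \<times> {..<n}"
  shows "\<not> inj_on (\<lambda>x. (chebyshev_dist s x, chebyshev_dist t x)) ({..<n} \<times> {..<n})"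
    (is "\<not> inj_on ?f ?V")
proof
  assume "inj_on ?f ?V"
  \<comment> \<open>A first entry \<open>0\<close> forces the vertex to be \<open>s\<close>, whose
    value is the inserted one.\<close>
  moreover have "?f ` ?V \<subseteq> insert (?f s) ({1..<n} \<times> {..<n})"
    using assms(2,3) chebyshev_dist_less
    by (auto simp: Suc_le_eq chebyshev_dist_eq_0_iff simp flip: neq0_conv)
  ultimately have "card ?V \<le> card (insert (?f s) ({1..<n} \<times> {..<n}))"
    by (intro card_inj_on_le) auto
  also have "\<dots> \<le> Suc ((n - 1) * n)"
    by (rule order_trans[OF card_insert_le_m1[of "Suc ((n - 1) * n)"]]) auto
  \<comment> \<open>For \<open>n = Suc m\<close> the inequality reduces to \<open>m = 0\<close>,
    against \<open>n \<ge> 2\<close>.\<close>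
  finally show False
    using assms(1) by (cases n) auto
qed

lemma card_metric_generator_grid_ge:
  assumes "n \<ge> 2" "metric_generator (path_graph n \<boxtimes> path_graph n) S" "finite S"
  shows "3 \<le> card S"
proof (rule ccontr)
  assume "\<not> 3 \<le> card S"
  have S: "S \<subseteq> {..<n} \<times> {..<n}"
    using assms(2) by (simp add: metric_generator_grid_iff)
  \<comment> \<open>\<open>s\<close> and \<open>t\<close> may coincide and need not lie in
    \<open>S\<close>, so smaller sets are padded to a pair; \<open>(0, 0)\<close> is the filler for
    the empty set.\<close>
  obtain s t where st: "s \<in> {..<n} \<times> {..<n}" "t \<in> {..<n} \<times> {..<n}" "S \<subseteq> {s, t}"
  proof -
    have "card S = 0 \<or> card S = 1 \<or> card S = 2"
      using \<open>\<not> 3 \<le> card S\<close> by auto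
    then consider "S = {}" | s where "S = {s}" | s t where "S = {s, t}"
      using assms(3) by (auto simp: card_1_singleton_iff card_2_iff)
    then show ?thesis
    proof cases
      case 1
      then show ?thesis using that[of "(0, 0)" "(0, 0)"] assms(1) by auto
    next
      case 2
      then show ?thesis using that S by blast
    next
      case 3
      then show ?thesis using that S by blast
    qed
  qed
  from two_vertices_not_resolving[OF assms(1) st(1,2)] obtain x y
    where "x \<in> {..<n} \<times> {..<n}" "y \<in> {..<n} \<times> {..<n}" "x \<noteq> y"
      and "chebyshev_dist s x = chebyshev_dist s y" "chebyshev_dist t x = chebyshev_dist t y"
    unfolding inj_on_def by blast
  with assms(2) st(3) show False
    unfolding metric_generator_grid_iff by blast
qed

theorem theorem6:
  fixes n :: nat
  assumes "n \<ge> 2"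
  shows "metric_dim (path_graph n \<boxtimes> path_graph n) = 3"
  unfolding metric_dim_def
proof (rule Least_equality)
  \<comment> \<open>The corners are distinct because \<open>n - 1 > 0\<close>, so the cardinality is
    exactly 3.\<close>
  show "\<exists>S. metric_generator (path_graph n \<boxtimes> path_graph n) S \<and> finite S \<and> card S = 3"
    using three_corners_generate[OF assms] assms
    by (intro exI[of _ "{(0, 0), (0, n - 1), (n - 1, 0)}"]) auto
qed (use card_metric_generator_grid_ge[OF assms] in blast)

end
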